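(* Let $ABC$ and $A_1B_1C_1$ be two triangles in the Euclidean plane. If the triangle $ABC$ is orthologic in rapport to the triangle $A_1B_1C_1$ and also orthologic in rapport to the triangle $B_1C_1A_1$ (vertices taken in the written order), then the triangle $ABC$ is also orthologic in rapport to the triangle $C_1A_1B_1$.
   Context: All points lie in a fixed Euclidean plane, and triangles are non-degenerate with ordered vertices. For triangles $XYZ$ and $X'Y'Z'$ (ordered triples of vertices), $XYZ$ is said to be orthologic in rapport to $X'Y'Z'$ if the following three lines are concurrent, i.e. pass through a common point: the line through $X$ perpendicular to the line $Y'Z'$, the line through $Y$ perpendicular to the line $Z'X'$, and the line through $Z$ perpendicular to the line $X'Y'$. The order of the vertices matters: for example, $ABC$ is orthologic in rapport to $B_1C_1A_1$ if the perpendiculars from $A, B, C$ to $C_1A_1, A_1B_1, B_1C_1$ respectively are concurrent, and $ABC$ is orthologic in rapport to $C_1A_1B_1$ if the perpendiculars from $A,B,C$ to $A_1B_1, B_1C_1, C_1A_1$ respectively are concurrent. *)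

theory Defs
  imports "HOL-Analysis.Analysis"
begin

type_synonym point = "real ^ 2"

(* collinear also holds when two of the points coincide, so the vertices are distinct. *)
definition is_triangle :: "point \<Rightarrow> point \<Rightarrow> point \<Rightarrow> bool" where
  "is_triangle X Y Z \<longleftrightarrow> \<not> collinear {X, Y, Z}"

(* The line through P perpendicular to the line QR; a genuine line only for Q \<noteq> R. *)
definition perp_line :: "point \<Rightarrow> point \<Rightarrow> point \<Rightarrow> point set" where
  "perp_line P Q R = {M. orthogonal (M - P) (R - Q)}"

lemma perp_line_is_line:
  assumes "Q \<noteq> R"
  shows "P \<in> perp_line P Q R" "affine (perp_line P Q R)" "aff_dim (perp_line P Q R) = 1"
proof -
  have eq: "perp_line P Q R = {M. (R - Q) \<bullet> M = (R - Q) \<bullet> P}"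
    by (auto simp: perp_line_def orthogonal_def inner_diff_right inner_commute inner_diff_left)
  show "P \<in> perp_line P Q R" by (simp add: eq)
  show "affine (perp_line P Q R)" unfolding eq by (rule affine_hyperplane)
  show "aff_dim (perp_line P Q R) = 1"
    unfolding eq using assms by (simp add: aff_dim_hyperplane)
qed

definition orthologic ::
  "point \<Rightarrow> point \<Rightarrow> point \<Rightarrow> point \<Rightarrow> point \<Rightarrow> point \<Rightarrow> bool" where
  "orthologic X Y Z X' Y' Z' \<longleftrightarrow>
     (\<exists>M. M \<in> perp_line X Y' Z' \<and> M \<in> perp_line Y Z' X' \<and> M \<in> perp_line Z X' Y')"

end

theory Submission
  imports Defs
begin

text \<open>
  Triangle \<open>XYZ\<close> is orthologic in rapport to a nondegenerate triangle \<open>X'Y'Z'\<close> if and only if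
  \<open>X \<bullet> (Z' - Y') + Y \<bullet> (X' - Z') + Z \<bullet> (Y' - X') = 0\<close>. The three sums obtained by cyclically
  permuting the second triangle add up to zero, so if two of them vanish, so does the third.
\<close>

text \<open>By the equality case of Cauchy-Schwarz, the Gram determinant \<open>G\<close> of
  \<open>u\<close> and \<open>v\<close> is nonzero.\<close>

lemma not_collinear_solve_inner:
  fixes u v :: "'a::real_inner"
  assumes "\<not> collinear {0, u, v}"
  obtains x where "x \<bullet> u = a" "x \<bullet> v = b"
proof
  define G where "G = (u \<bullet> u) * (v \<bullet> v) - (u \<bullet> v)\<^sup>2"
  have "\<bar>u \<bullet> v\<bar> \<noteq> \<bar>norm u * norm v\<bar>"
    using assms norm_cauchy_schwarz_equal[of u v] by (simp add: abs_mult)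
  then have "(u \<bullet> v)\<^sup>2 \<noteq> (norm u * norm v)\<^sup>2"
    by (metis real_sqrt_abs)
  then have G: "G \<noteq> 0"
    by (simp add: G_def power_mult_distrib power2_norm_eq_inner)
  \<comment> \<open>Cramer's rule for the coefficients of \<open>x\<close> in the span of
    \<open>u\<close> and \<open>v\<close>.\<close>
  define x where "x = ((a * (v \<bullet> v) - b * (u \<bullet> v)) / G) *\<^sub>R u + ((b * (u \<bullet> u) - a * (u \<bullet> v)) / G) *\<^sub>R v"
  have "(x \<bullet> u) * G = a * G" "(x \<bullet> v) * G = b * G"
    using G by (simp_all add: x_def inner_add_left inner_commute[of v u] distrib_right)
      (simp_all add: G_def algebra_simps power2_eq_square)
  then show "x \<bullet> u = a" "x \<bullet> v = b"
    using G by simp_all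
qed

text \<open>Adding the three perpendicularity equations eliminates \<open>M\<close>, because the
  side vectors sum to zero.\<close>

lemma orthologic_iff_sum_inner_eq_0:
  assumes "is_triangle X' Y' Z'"
  shows "orthologic X Y Z X' Y' Z' \<longleftrightarrow> X \<bullet> (Z' - Y') + Y \<bullet> (X' - Z') + Z \<bullet> (Y' - X') = 0"
proof
  assume "orthologic X Y Z X' Y' Z'"
  then show "X \<bullet> (Z' - Y') + Y \<bullet> (X' - Z') + Z \<bullet> (Y' - X') = 0"
    by (auto simp: orthologic_def perp_line_def orthogonal_def inner_diff_left inner_diff_right)
next
  assume sum: "X \<bullet> (Z' - Y') + Y \<bullet> (X' - Z') + Z \<bullet> (Y' - X') = 0"
  \<comment> \<open>\<open>Z'\<close> goes in the middle because \<open>collinear_3\<close>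
    subtracts the middle point.\<close>
  have "\<not> collinear {X', Z', Y'}"
    using assms by (simp add: is_triangle_def insert_commute)
  then have "\<not> collinear {0, X' - Z', Y' - Z'}"
    by (simp add: collinear_3)
  \<comment> \<open>\<open>M\<close> is where the perpendiculars from \<open>Y\<close> and
    \<open>X\<close> meet; \<open>sum\<close> then puts it on the one from \<open>Z\<close>.\<close>
  then obtain M where "M \<bullet> (X' - Z') = Y \<bullet> (X' - Z')" "M \<bullet> (Y' - Z') = X \<bullet> (Y' - Z')"
    by (rule not_collinear_solve_inner)
  with sum show "orthologic X Y Z X' Y' Z'"
    by (auto simp: orthologic_def perp_line_def orthogonal_def inner_diff_left inner_diff_right
        intro!: exI[of _ M])
qed

theorem mainTheorem1:
  fixes A B C A\<^sub>1 B\<^sub>1 C\<^sub>1 :: point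
  assumes "is_triangle A B C"
    and "is_triangle A\<^sub>1 B\<^sub>1 C\<^sub>1"
    and "orthologic A B C A\<^sub>1 B\<^sub>1 C\<^sub>1"
    and "orthologic A B C B\<^sub>1 C\<^sub>1 A\<^sub>1"
  shows "orthologic A B C C\<^sub>1 A\<^sub>1 B\<^sub>1"
proof -
  have "is_triangle B\<^sub>1 C\<^sub>1 A\<^sub>1" "is_triangle C\<^sub>1 A\<^sub>1 B\<^sub>1"
    using assms(2) by (simp_all add: is_triangle_def insert_commute)
  with assms(2-4) show ?thesis
    by (simp add: orthologic_iff_sum_inner_eq_0 inner_diff_right)
qed

end
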